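(* Let $R=Q/P$ be a nonconstant rational function with $P,Q\in\mathbb{C}[z]$ coprime. If $R$ is a polynomial, then every connected component of the affine inflection curve $\mathfrak{I}_R\subset\mathbb{C}$ is unbounded. More generally, if all finite poles of $R$ are simple and $\mathfrak{I}_R$ is nonsingular away from them, then the number of bounded connected components of $\mathfrak{I}_R$ is at most the number of finite poles of $R$, and hence at most $\deg P$.
   Context: The affine inflection curve $\mathfrak{I}_R$ is the closure in $\mathbb{C}$ of $\{z\in\mathbb{C}: R(z)\neq0,\ P(z)\neq0,\ \operatorname{Im}R'(z)=0\}$; equivalently it is the zero set in $\mathbb{C}$ of $F_R=\frac{1}{2i}\bigl(W\overline{P}^{\,2}-\overline{W}P^2\bigr)$ with $W=Q'P-QP'$. *)

theory Defs
  imports "HOL-Complex_Analysis.Complex_Analysis" "HOL-Computational_Algebra.Polynomial"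
begin

(* The rational function R = Q/P. At the zeros of P the value is the junk value 0; below,
   R is only evaluated where P is nonzero, and is_pole / zorder ignore the value at the point. *)
definition ratfun :: "complex poly \<Rightarrow> complex poly \<Rightarrow> complex \<Rightarrow> complex" where
  "ratfun Q P z = poly Q z / poly P z"

definition ratfun_is_polynomial :: "complex poly \<Rightarrow> complex poly \<Rightarrow> bool" where
  "ratfun_is_polynomial Q P \<longleftrightarrow> (\<exists>S. \<forall>z. poly P z \<noteq> 0 \<longrightarrow> ratfun Q P z = poly S z)"

definition finite_poles :: "complex poly \<Rightarrow> complex poly \<Rightarrow> complex set" where
  "finite_poles Q P = {z. is_pole (ratfun Q P) z}"

definition inflection_curve :: "complex poly \<Rightarrow> complex poly \<Rightarrow> complex set" where
  "inflection_curve Q P =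
     closure {z. ratfun Q P z \<noteq> 0 \<and> poly P z \<noteq> 0 \<and> Im (deriv (ratfun Q P) z) = 0}"

(* F_R: a real polynomial in Re z and Im z, regarded as a complex-valued function. *)
definition inflection_form :: "complex poly \<Rightarrow> complex poly \<Rightarrow> complex \<Rightarrow> complex" where
  "inflection_form Q P z =
     (let W = pderiv Q * P - Q * pderiv P
      in (poly W z * cnj (poly P z) ^ 2 - cnj (poly W z) * poly P z ^ 2) / (2 * \<i>))"

lemma inflection_form_real:
  "inflection_form Q P z =
     of_real (Im (poly (pderiv Q * P - Q * pderiv P) z * cnj (poly P z) ^ 2))"
proof -
  have "(w - cnj w) / (2 * \<i>) = of_real (Im w)" for w
    by (simp add: complex_eq_iff complex_diff_cnj)
  from this[of "poly (pderiv Q * P - Q * pderiv P) z * cnj (poly P z) ^ 2"]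
  show ?thesis by (simp add: inflection_form_def Let_def)
qed

(* A point of the real plane curve F_R = 0 is nonsingular iff the gradient of F_R, i.e. its
   real (Frechet) derivative as a map on the plane, does not vanish there. *)
definition nonsingular_at :: "complex poly \<Rightarrow> complex poly \<Rightarrow> complex \<Rightarrow> bool" where
  "nonsingular_at Q P z \<longleftrightarrow> frechet_derivative (inflection_form Q P) (at z) \<noteq> (\<lambda>_. 0)"

lemma inflection_form_differentiable: "inflection_form Q P differentiable (at z)"
proof -
  have p: "poly A differentiable (at z)" for A :: "complex poly"
    using poly_DERIV[of A z] by (auto simp: differentiable_def has_field_derivative_def)
  have c: "(\<lambda>x. cnj (poly A x)) differentiable (at z)" for A :: "complex poly"
    using p[of A] unfolding differentiable_def by (blast intro: has_derivative_cnj)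
  show ?thesis
    unfolding inflection_form_def[abs_def] Let_def divide_inverse
    by (intro differentiable_mult differentiable_diff differentiable_power p c differentiable_const)
qed

definition bounded_components :: "complex set \<Rightarrow> complex set set" where
  "bounded_components S = {C \<in> components S. bounded C}"

end

theory Submission
  imports Defs
begin

(* Off the poles of R the curve is the preimage of the real line under R'. By the open mapping
   theorem, a compact relatively open piece of it containing no pole would have an image that is
   nonempty, compact and open in the real line, which is impossible. Hence every bounded
   component contains a pole of R, and distinct components contain distinct poles. *)

lemma compact_real_preimage_empty:
  fixes f :: "complex \<Rightarrow> complex"
  assumes "f holomorphic_on S" "open S" "connected S" "\<not> f constant_on S"
    and "open T" "T \<subseteq> S" and compact: "compact {z \<in> T. Im (f z) = 0}"
  shows "{z \<in> T. Im (f z) = 0} = {}"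
proof -
  define X where "X = {t. complex_of_real t \<in> f ` T}"
  have "open (f ` T)"
    using open_mapping_thm assms by blast
  moreover have "X = complex_of_real -` (f ` T)"
    by (auto simp: X_def)
  ultimately have "open X"
    by (auto intro!: open_vimage continuous_intros)
  have X_eq: "X = (\<lambda>z. Re (f z)) ` {z \<in> T. Im (f z) = 0}"
    by (force simp: X_def image_iff complex_eq_iff)
  have "continuous_on {z \<in> T. Im (f z) = 0} f"
    using assms(1,6) by (blast intro: continuous_on_subset holomorphic_on_imp_continuous_on)
  then have "compact X"
    unfolding X_eq by (intro compact_continuous_image compact continuous_intros)
  \<comment> \<open>The real line is connected and not compact, so a clopen compact subset of it can
    only be empty.\<close>
  then have "closed X" "X \<noteq> UNIV"
    using compact_imp_closed not_compact_UNIV by auto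
  then have "X = {}"
    using \<open>open X\<close> clopen[of X] by auto
  then show ?thesis
    unfolding X_eq by blast
qed

text \<open>A finite set has empty interior. This serves the degenerate case of a real constant
  derivative, where the curve is the whole plane.\<close>

lemma closure_cofinite:
  fixes S :: "'a::euclidean_space set"
  assumes "finite (- S)"
  shows "closure S = UNIV"
  using assms by (simp add: closure_interior empty_interior_finite)

context
  fixes P Q :: "complex poly"
  assumes P_nz: "P \<noteq> 0"
begin

lemma open_nonpoles: "open {z. poly P z \<noteq> 0}"
  by (intro open_Collect_neq continuous_intros)

text \<open>Removing countably many points does not disconnect the plane. The open mapping theorem
  is applied to R' on this domain.\<close>

lemma connected_nonpoles: "connected {z. poly P z \<noteq> 0}"
proof -
  have "connected (UNIV - {z. poly P z = 0})"
    using P_nz by (intro connected_open_diff_countable)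
      (auto intro: countable_finite poly_roots_finite)
  moreover have "UNIV - {z. poly P z = 0} = {z. poly P z \<noteq> 0}"
    by auto
  ultimately show ?thesis by simp
qed

lemma ratfun_holomorphic: "ratfun Q P holomorphic_on {z. poly P z \<noteq> 0}"
  unfolding ratfun_def[abs_def] by (intro holomorphic_intros) auto

lemma deriv_ratfun_holomorphic: "deriv (ratfun Q P) holomorphic_on {z. poly P z \<noteq> 0}"
  by (intro holomorphic_deriv ratfun_holomorphic open_nonpoles)

lemma finite_poles_subset: "finite_poles Q P \<subseteq> {z. poly P z = 0}"
  using not_is_pole_holomorphic[OF open_nonpoles _ ratfun_holomorphic]
  by (auto simp: finite_poles_def)

lemma finite_finite_poles: "finite (finite_poles Q P)"
  using finite_poles_subset poly_roots_finite[OF P_nz] by (rule finite_subset)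

lemma card_finite_poles_le: "card (finite_poles Q P) \<le> degree P"
  using card_mono[OF poly_roots_finite[OF P_nz] finite_poles_subset] card_poly_roots_bound[OF P_nz]
  by linarith

text \<open>By coprimality the numerator is nonzero at a root of \<open>P\<close>, so nothing
  cancels. Hence a set avoiding the poles lies where R' is holomorphic.\<close>

lemma finite_poles_eq:
  assumes "coprime P Q"
  shows "finite_poles Q P = {z. poly P z = 0}"
proof (rule antisym[OF finite_poles_subset], safe)
  fix z assume z: "poly P z = 0"
  have "(\<lambda>x. poly P x) \<midarrow>z\<rightarrow> 0"
    using poly_isCont[of z P] z by (simp add: isCont_def)
  \<comment> \<open>Roots of \<open>P\<close> are isolated, so \<open>poly P\<close> tends to 0
    through nonzero values.\<close>
  moreover have "\<forall>\<^sub>F x in at z. poly P x \<noteq> 0"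
    using islimpt_finite[OF poly_roots_finite[OF P_nz], of z] by (simp add: islimpt_iff_eventually)
  ultimately have "filterlim (poly P) (at 0) (at z)"
    by (simp add: filterlim_at)
  moreover have "poly Q z \<noteq> 0"
    using coprime_poly_0[OF assms, of z] z by simp
  ultimately have "is_pole (\<lambda>z. poly Q z / poly P z) z"
    by (intro is_pole_divide) auto
  then show "z \<in> finite_poles Q P"
    by (simp add: finite_poles_def ratfun_def[abs_def])
qed

lemma finite_poles_polynomial:
  assumes "coprime P Q" "ratfun_is_polynomial Q P"
  shows "finite_poles Q P = {}"
proof -
  obtain S where S: "\<And>z. poly P z \<noteq> 0 \<Longrightarrow> ratfun Q P z = poly S z"
    using assms(2) by (auto simp: ratfun_is_polynomial_def)
  \<comment> \<open>The extra factor \<open>P\<close> makes the product vanish also at the roots of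
    \<open>P\<close>, where nothing is known about \<open>S\<close>.\<close>
  have "P * (Q - S * P) = 0"
    using S by (intro poly_all_0_iff_0[THEN iffD1]) (auto simp: ratfun_def field_simps)
  then have "P dvd Q"
    using P_nz by simp
  then have "is_unit P"
    using assms(1) by (simp add: coprime_absorb_left)
  then obtain c where "P = [:c:]" "c \<noteq> 0"
    using is_unit_polyE[of P] P_nz by (metis pCons_0_0)
  then show ?thesis
    using finite_poles_subset by auto
qed

text \<open>Brings the curve into the form to which \<open>compact_real_preimage_empty\<close>
  applies. The inclusion from left to right is continuity of R'.\<close>

lemma inflection_curve_Int_nonpoles:
  assumes "Q \<noteq> 0" and nc: "\<not> deriv (ratfun Q P) constant_on {z. poly P z \<noteq> 0}"
  shows "inflection_curve Q P \<inter> {z. poly P z \<noteq> 0} =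
         {z. poly P z \<noteq> 0 \<and> Im (deriv (ratfun Q P) z) = 0}"
proof -
  let ?f = "deriv (ratfun Q P)"
  define A where "A = {z. ratfun Q P z \<noteq> 0 \<and> poly P z \<noteq> 0 \<and> Im (?f z) = 0}"
  have "Im (?f z) = 0" if z: "z \<in> closure A" "poly P z \<noteq> 0" for z
  proof (rule ccontr)
    assume "Im (?f z) \<noteq> 0"
    have "continuous_on {z. poly P z \<noteq> 0} (\<lambda>z. Im (?f z))"
      by (intro continuous_intros holomorphic_on_imp_continuous_on deriv_ratfun_holomorphic)
    then have "open ((\<lambda>z. Im (?f z)) -` (- {0}) \<inter> {z. poly P z \<noteq> 0})"
      using continuous_on_open_vimage[OF open_nonpoles] by blast
    moreover have "z \<in> (\<lambda>z. Im (?f z)) -` (- {0}) \<inter> {z. poly P z \<noteq> 0}"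
      using z \<open>Im (?f z) \<noteq> 0\<close> by simp
    ultimately show False
      using z(1) unfolding closure_iff_nhds_not_empty A_def by blast
  qed
  \<comment> \<open>The points of the preimage that are zeros of \<open>R\<close> are recovered as limits of nearby ones
      because \<open>R'\<close> is open, so it takes further real values near them.\<close>
  moreover have "z \<in> closure A" if z: "poly P z \<noteq> 0" "Im (?f z) = 0" for z
    unfolding closure_iff_nhds_not_empty
  proof (intro allI impI)
    fix B V :: "complex set"
    assume "V \<subseteq> B" "open V" "z \<in> V"
    \<comment> \<open>Every zero of \<open>Q\<close> except possibly \<open>z\<close> is removed, so
      R is nonzero at each point of \<open>U\<close> other than \<open>z\<close>.\<close>
    define U where "U = V \<inter> {z. poly P z \<noteq> 0} - ({z. poly Q z = 0} - {z})"
    have "open U"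
      unfolding U_def using \<open>open V\<close> open_nonpoles poly_roots_finite[OF \<open>Q \<noteq> 0\<close>]
      by (intro open_Diff open_Int finite_imp_closed) auto
    then have "open (?f ` U)"
      using nc by (intro open_mapping_thm[OF deriv_ratfun_holomorphic open_nonpoles connected_nonpoles])
        (auto simp: U_def)
    moreover have "?f z \<in> ?f ` U"
      using z \<open>z \<in> V\<close> by (auto simp: U_def)
    ultimately obtain e where e: "e > 0" "ball (?f z) e \<subseteq> ?f ` U"
      using openE by blast
    \<comment> \<open>A real shift keeps the value real, and being nonzero it forces the preimage
      \<open>w\<close> to differ from \<open>z\<close>.\<close>
    have "?f z + of_real (e/2) \<in> ball (?f z) e"
      using e(1) by (simp add: dist_norm)
    then obtain w where w: "w \<in> U" "?f w = ?f z + of_real (e/2)"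
      using e(2) by (metis imageE subsetD)
    then have "w \<noteq> z"
      using e(1) by auto
    then have "w \<in> A"
      using w z by (auto simp: A_def U_def ratfun_def)
    then show "A \<inter> B \<noteq> {}"
      using w \<open>V \<subseteq> B\<close> by (auto simp: U_def)
  qed
  moreover have "inflection_curve Q P = closure A"
    by (simp only: inflection_curve_def A_def)
  ultimately show ?thesis
    by blast
qed

lemma bounded_component_contains_pole:
  assumes "coprime P Q" "Q \<noteq> 0"
    and C: "C \<in> components (inflection_curve Q P)" "bounded C"
  shows "C \<inter> finite_poles Q P \<noteq> {}"
proof
  let ?f = "deriv (ratfun Q P)" and ?N = "{z. poly P z \<noteq> 0}"
  assume "C \<inter> finite_poles Q P = {}"
  then have CN: "C \<subseteq> ?N"
    using finite_poles_eq[OF assms(1)] by auto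
  have closed: "closed (inflection_curve Q P)"
    by (simp add: inflection_curve_def)
  have "compact C"
    using C closed_components[OF closed] by (simp add: compact_eq_bounded_closed)
  have "C \<noteq> {}" "C \<subseteq> inflection_curve Q P"
    using in_components_nonempty[OF C(1)] in_components_subset[OF C(1)] by auto
  show False
  \<comment> \<open>The open mapping theorem excludes constant R'. In that case the curve is the
    whole plane or empty, according to whether the constant is real.\<close>
  proof (cases "?f constant_on ?N")
    case True
    then obtain c where c: "\<And>z. z \<in> ?N \<Longrightarrow> ?f z = c"
      by (auto simp: constant_on_def)
    show False
    proof (cases "Im c = 0")
      case True
      have "finite ({z. poly Q z = 0} \<union> {z. poly P z = 0})"
        using P_nz \<open>Q \<noteq> 0\<close> poly_roots_finite by blast
      then have "finite (- {z. ratfun Q P z \<noteq> 0 \<and> poly P z \<noteq> 0 \<and> Im (?f z) = 0})"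
        by (rule rev_finite_subset) (use c True in \<open>auto simp: ratfun_def\<close>)
      then have "inflection_curve Q P = UNIV"
        unfolding inflection_curve_def by (rule closure_cofinite)
      then have "C = UNIV"
        using C(1) by (simp add: components_UNIV)
      then show False
        using C(2) not_bounded_UNIV by simp
    next
      case False
      then have "{z. ratfun Q P z \<noteq> 0 \<and> poly P z \<noteq> 0 \<and> Im (?f z) = 0} = {}"
        using c by auto
      then have "inflection_curve Q P = {}"
        by (simp only: inflection_curve_def closure_empty)
      then show False
        using \<open>C \<noteq> {}\<close> \<open>C \<subseteq> inflection_curve Q P\<close> by simp
    qed
  next
    case False
    \<comment> \<open>A component need not be relatively open in the curve. The Sura-Bura theorem
      encloses the compact component \<open>C\<close> in a compact relatively open \<open>K\<close>
      that still avoids the roots of \<open>P\<close>.\<close>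
    obtain K where K: "openin (top_of_set (inflection_curve Q P)) K" "compact K" "C \<subseteq> K" "K \<subseteq> ?N"
      using Sura_Bura_clopen_subset[OF closed_imp_locally_compact[OF closed] C(1) \<open>compact C\<close>
          open_nonpoles CN] .
    obtain T where T: "open T" "K = inflection_curve Q P \<inter> T"
      using K(1) by (auto simp: openin_open)
    have K_eq: "K = {z \<in> T \<inter> ?N. Im (?f z) = 0}"
      using inflection_curve_Int_nonpoles[OF \<open>Q \<noteq> 0\<close> False] T(2) K(4) by blast
    have "{z \<in> T \<inter> ?N. Im (?f z) = 0} = {}"
    proof (rule compact_real_preimage_empty)
      show "compact {z \<in> T \<inter> ?N. Im (?f z) = 0}"
        using K(2) K_eq by simp
    qed (use T(1) False deriv_ratfun_holomorphic open_nonpoles connected_nonpoles in auto)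
    then show False
      using K(3) K_eq \<open>C \<noteq> {}\<close> by auto
  qed
qed

end

theorem corollary5p5:
  fixes P Q :: "complex poly"
  assumes "P \<noteq> 0" and "coprime P Q"
    and nonconstant: "\<not> ratfun Q P constant_on {z. poly P z \<noteq> 0}"
  shows "(ratfun_is_polynomial Q P \<longrightarrow>
            (\<forall>C \<in> components (inflection_curve Q P). \<not> bounded C)) \<and>
         ((\<forall>z \<in> finite_poles Q P. zorder (ratfun Q P) z = - 1) \<and>
          (\<forall>z \<in> inflection_curve Q P - finite_poles Q P. nonsingular_at Q P z) \<longrightarrow>
            finite (bounded_components (inflection_curve Q P)) \<and>
            card (bounded_components (inflection_curve Q P)) \<le> card (finite_poles Q P) \<and>
            card (bounded_components (inflection_curve Q P)) \<le> degree P)"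
proof -
  have "Q \<noteq> 0"
    using nonconstant by (auto simp: constant_on_def ratfun_def)
  note pole = bounded_component_contains_pole[OF assms(1,2) this]
  let ?B = "bounded_components (inflection_curve Q P)"
  have "\<forall>C \<in> ?B. \<exists>p. p \<in> C \<inter> finite_poles Q P"
    using pole by (fastforce simp: bounded_components_def)
  then obtain p where p: "\<And>C. C \<in> ?B \<Longrightarrow> p C \<in> C \<inter> finite_poles Q P"
    by metis
  \<comment> \<open>Distinct components are disjoint, so a chosen pole determines its
    component.\<close>
  have "inj_on p ?B"
  proof (rule inj_onI)
    fix C D assume "C \<in> ?B" "D \<in> ?B" "p C = p D"
    then show "C = D"
      using p[of C] p[of D] components_nonoverlap[of C "inflection_curve Q P" D]
      by (auto simp: bounded_components_def)
  qed
  moreover have "p ` ?B \<subseteq> finite_poles Q P"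
    using p by auto
  moreover note finite_finite_poles[OF assms(1), of Q]
  ultimately have "finite ?B" "card ?B \<le> card (finite_poles Q P)"
    using inj_on_finite card_inj_on_le by blast+
  moreover have "card ?B \<le> degree P"
    using \<open>card ?B \<le> card (finite_poles Q P)\<close> card_finite_poles_le[OF assms(1), of Q]
    by (rule order_trans)
  \<comment> \<open>A polynomial R has no finite pole for a bounded component to contain.\<close>
  moreover have "\<not> bounded C"
    if "ratfun_is_polynomial Q P" "C \<in> components (inflection_curve Q P)" for C
    using pole[OF that(2)] finite_poles_polynomial[OF assms(1,2) that(1)] by blast
  ultimately show ?thesis
    by blast
qed

end
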